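(* Let $\delta_0$ be the unique positive solution of $\frac{x}{2}(1+x)^{3/2}(3+x)\left[1+(1+x)^{3/2}\right]=1$, $x>0$. If $0<\delta<\delta_0$, then the only solution $\Phi_\delta$ in $K$ of the boundary value problem $$[(1+\delta y(x))y'(x)]'+2xy'(x)=0\quad (0<x<+\infty),\qquad y(0)=0,\qquad y(+\infty)=1$$ satisfies $$0\le\Phi_\delta(x)\le1,\qquad \Phi_\delta'(x)>0,\qquad \Phi_\delta''(x)<0\qquad\text{for all }x>0.$$
   Context: $K$ is the set of all non-negative (real) analytic functions on $\mathbb{R}_0^+=[0,+\infty)$ which are bounded by $1$. The condition $y(+\infty)=1$ means $\lim_{x\to+\infty}y(x)=1$. It is known from earlier work that for every $0\le\delta<\delta_0$ the boundary value problem has a unique solution $\Phi_\delta$ in $K$ (called the modified error function). *)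

theory Defs
  imports "HOL-Analysis.Analysis"
begin

text \<open>
  Real analyticity on an arbitrary set: around each point of the set, the function agrees on the
  set with a convergent power series. At a boundary point (such as 0 in the half-line) the
  expansion is one-sided, and values outside the set are irrelevant. (The library's
  \<open>analytic_on\<close> concerns complex functions only.)
\<close>

definition real_analytic_on :: "(real \<Rightarrow> real) \<Rightarrow> real set \<Rightarrow> bool" where
  "real_analytic_on f S \<longleftrightarrow>
     (\<forall>x0\<in>S. \<exists>r>0. \<exists>a :: nat \<Rightarrow> real.
        \<forall>x\<in>S. \<bar>x - x0\<bar> < r \<longrightarrow> (\<lambda>n. a n * (x - x0) ^ n) sums f x)"

text \<open>
  Functions on the half-line are represented by total functions whose values at negative
  arguments are unconstrained.
\<close>

definition K :: "(real \<Rightarrow> real) set" where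
  "K = {y. real_analytic_on y {0..} \<and> (\<forall>x\<ge>0. 0 \<le> y x \<and> y x \<le> 1)}"

text \<open>
  The differentiability requirements guard against the arbitrary value of \<open>deriv\<close> at points of
  non-differentiability; they hold automatically for members of \<open>K\<close>.
\<close>

definition solves_bvp :: "real \<Rightarrow> (real \<Rightarrow> real) \<Rightarrow> bool" where
  "solves_bvp \<delta> y \<longleftrightarrow>
     (\<forall>x>0. y differentiable (at x) \<and>
            (\<lambda>t. (1 + \<delta> * y t) * deriv y t) differentiable (at x) \<and>
            deriv (\<lambda>t. (1 + \<delta> * y t) * deriv y t) x + 2 * x * deriv y x = 0) \<and>
     y 0 = 0 \<and> (y \<longlongrightarrow> 1) at_top"

definition delta0_fun :: "real \<Rightarrow> real" where
  "delta0_fun x = x / 2 * (1 + x) powr (3/2) * (3 + x) * (1 + (1 + x) powr (3/2))"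

definition delta0 :: real where
  "delta0 = (THE x. x > 0 \<and> delta0_fun x = 1)"

lemma delta0_fun_strict_mono:
  assumes "0 \<le> x" "x < y"
  shows "delta0_fun x < delta0_fun y"
proof -
  have p: "(1 + x) powr (3/2) < (1 + y) powr (3/2)"
    using assms by (intro powr_less_mono2) auto
  have p0: "0 < (1 + x) powr (3/2)" using assms by simp
  show ?thesis unfolding delta0_fun_def
    using assms p p0 by (intro mult_strict_mono) auto
qed

lemma delta0_ex1: "\<exists>!x. x > 0 \<and> delta0_fun x = 1"
proof -
  have "(1::real) powr (3/2) \<le> 2 powr (3/2)" by (intro powr_mono2) auto
  hence b: "(1::real) \<le> 2 powr (3/2)" by simp
  have "1 * 1 \<le> (2::real) powr (3/2) * (1 + 2 powr (3/2))"
    using b by (intro mult_mono) auto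
  hence 1: "delta0_fun 1 \<ge> 1" by (simp add: delta0_fun_def)
  have "\<exists>x\<ge>0. x \<le> 1 \<and> delta0_fun x = 1"
    using 1 by (intro IVT') (auto simp: delta0_fun_def intro!: continuous_intros)
  then obtain x where x: "x \<ge> 0" "delta0_fun x = 1" by blast
  moreover have "x \<noteq> 0" using x by (auto simp: delta0_fun_def)
  ultimately have "x > 0 \<and> delta0_fun x = 1" by simp
  moreover have "y = x" if "y > 0 \<and> delta0_fun y = 1" for y
    using delta0_fun_strict_mono[of x y] delta0_fun_strict_mono[of y x] that x
    by (cases x y rule: linorder_cases) auto
  ultimately show ?thesis by blast
qed

end

theory Submission
  imports Defs
begin

text \<open>
  The flux \<open>w = (1 + \<delta> y) y'\<close> satisfies the linear equation \<open>w' = - g w\<close> with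
  \<open>g x = 2 x / (1 + \<delta> y x)\<close>, so \<open>0 \<le> g x \<le> 2 x\<close>. Hence \<open>w\<^sup>2\<close> is nonincreasing while
  \<open>w\<^sup>2 exp (2 x\<^sup>2)\<close> is nondecreasing, and a single zero of \<open>w\<close> on the open half-line would make \<open>w\<close>
  vanish there identically. The boundary values force \<open>y' > 0\<close> somewhere, hence everywhere,
  and then \<open>(1 + \<delta> y) y'' = - 2 x y' - \<delta> y'\<^sup>2 < 0\<close>.
\<close>

text \<open>Near 0 the function agrees on the half-line with a power series, whose sum is continuous
  inside its disc of convergence. This supplies continuity at the endpoint, where the differential
  equation gives no information.\<close>

lemma real_analytic_on_imp_continuous_within_0:
  assumes "real_analytic_on f {0..}"
  shows "continuous (at 0 within {0..}) f"
proof -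
  obtain r a where r: "r > 0"
    and a: "\<And>x. x \<ge> 0 \<Longrightarrow> \<bar>x\<bar> < r \<Longrightarrow> (\<lambda>n. a n * x ^ n) sums f x"
    using assms unfolding real_analytic_on_def by force
  have "summable (\<lambda>n. a n * (r / 2) ^ n)"
    using a[of "r / 2"] r by (auto simp: sums_iff)
  then have "isCont (\<lambda>x. \<Sum>n. a n * x ^ n) 0"
    by (rule isCont_powser) (use r in auto)
  then have cont: "continuous (at 0 within {0..}) (\<lambda>x. \<Sum>n. a n * x ^ n)"
    by (rule continuous_at_imp_continuous_at_within)
  show ?thesis
    by (rule continuous_transform_within[OF cont r])
       (use a in \<open>auto simp: sums_iff dist_real_def\<close>)
qed

text \<open>Each monotone quantity is nonnegative and vanishes at \<open>c\<close>, hence is zero on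
  one side of \<open>c\<close>: the lower bound on \<open>g\<close> carries the zero to the right,
  the upper bound to the left.\<close>

lemma linear_decay_zero:
  fixes w g :: "real \<Rightarrow> real"
  assumes w: "\<And>x. x > 0 \<Longrightarrow> (w has_real_derivative - g x * w x) (at x)"
    and g0: "\<And>x. x > 0 \<Longrightarrow> 0 \<le> g x" and g2: "\<And>x. x > 0 \<Longrightarrow> g x \<le> 2 * x"
    and c: "c > 0" "w c = 0" and x: "x > 0"
  shows "w x = 0"
proof (cases "c \<le> x")
  case True
  have "(w x)\<^sup>2 \<le> (w c)\<^sup>2"
  proof (rule DERIV_nonpos_imp_nonincreasing[OF True])
    fix t assume "c \<le> t"
    then have "t > 0" using c by simp
    have "((\<lambda>t. (w t)\<^sup>2) has_real_derivative - 2 * g t * (w t)\<^sup>2) (at t)"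
      by (auto intro!: derivative_eq_intros w \<open>t > 0\<close> simp: power2_eq_square)
    moreover have "- 2 * g t * (w t)\<^sup>2 \<le> 0"
      using g0[OF \<open>t > 0\<close>] by simp
    ultimately show "\<exists>d. ((\<lambda>t. (w t)\<^sup>2) has_real_derivative d) (at t) \<and> d \<le> 0"
      by blast
  qed
  then show ?thesis using c by simp
next
  case False
  then have "x \<le> c" by simp
  then have "(w x)\<^sup>2 * exp (2 * x\<^sup>2) \<le> (w c)\<^sup>2 * exp (2 * c\<^sup>2)"
  proof (rule DERIV_nonneg_imp_nondecreasing)
    fix t assume "x \<le> t"
    then have t: "t > 0" using x by simp
    show "\<exists>d. ((\<lambda>t. (w t)\<^sup>2 * exp (2 * t\<^sup>2)) has_real_derivative d) (at t) \<and> 0 \<le> d"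
    \<comment> \<open>The weight has logarithmic derivative \<open>4 * t\<close>, which dominates
      the decay rate \<open>2 * g t\<close> of the square of \<open>w\<close>.\<close>
    proof (intro exI[of _ "2 * (2 * t - g t) * (w t)\<^sup>2 * exp (2 * t\<^sup>2)"] conjI)
      show "((\<lambda>t. (w t)\<^sup>2 * exp (2 * t\<^sup>2)) has_real_derivative
               2 * (2 * t - g t) * (w t)\<^sup>2 * exp (2 * t\<^sup>2)) (at t)"
        by (auto intro!: derivative_eq_intros w t simp: power2_eq_square algebra_simps)
      show "0 \<le> 2 * (2 * t - g t) * (w t)\<^sup>2 * exp (2 * t\<^sup>2)"
        using g2[OF t] by simp
    qed
  qed
  then show ?thesis using c by (simp add: mult_le_0_iff)
qed

theorem theorem5p1:
  fixes \<delta> :: real and \<Phi> :: "real \<Rightarrow> real"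
  assumes "0 < \<delta>" and "\<delta> < delta0"
    and "\<Phi> \<in> K" and "solves_bvp \<delta> \<Phi>"
  shows "\<forall>x>0. 0 \<le> \<Phi> x \<and> \<Phi> x \<le> 1 \<and> deriv \<Phi> x > 0 \<and> deriv (deriv \<Phi>) x < 0"
proof -
  define w where "w = (\<lambda>t. (1 + \<delta> * \<Phi> t) * deriv \<Phi> t)"
  define g where "g = (\<lambda>t. 2 * t / (1 + \<delta> * \<Phi> t))"
  have bounds: "0 \<le> \<Phi> x" "\<Phi> x \<le> 1" if "x \<ge> 0" for x
    using assms(3) that by (auto simp: K_def)
  have coeff: "1 + \<delta> * \<Phi> x \<ge> 1" if "x > 0" for x
    using bounds(1)[of x] that assms(1) by simp
  have \<Phi>': "(\<Phi> has_real_derivative deriv \<Phi> x) (at x)" if "x > 0" for x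
    using assms(4) that
    by (auto simp: solves_bvp_def DERIV_deriv_iff_real_differentiable)
  have w': "(w has_real_derivative - 2 * x * deriv \<Phi> x) (at x)" if "x > 0" for x
  proof -
    have "w differentiable (at x)" "deriv w x = - 2 * x * deriv \<Phi> x"
      using assms(4) that by (auto simp: solves_bvp_def w_def eq_neg_iff_add_eq_0)
    then show ?thesis by (metis DERIV_deriv_iff_real_differentiable)
  qed
  have w_linear: "(w has_real_derivative - g x * w x) (at x)" if "x > 0" for x
  proof -
    have "- g x * w x = - 2 * x * deriv \<Phi> x"
      using coeff[OF that] by (simp add: w_def g_def)
    then show ?thesis using w'[OF that] by simp
  qed
  have g: "0 \<le> g x" "g x \<le> 2 * x" if "x > 0" for x
    using that coeff[OF that] by (auto simp: g_def divide_le_eq)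
  have w_sgn: "w x > 0 \<longleftrightarrow> deriv \<Phi> x > 0" if "x > 0" for x
    using coeff[OF that] by (auto simp: w_def zero_less_mult_iff)

  \<comment> \<open>The mean value theorem on \<open>{0..b}\<close>, with \<open>b\<close> so large
    that \<open>\<Phi> b\<close> exceeds \<open>\<Phi> 0 = 0\<close>, yields a point of positive
    slope.\<close>
  obtain c where c: "c > 0" "w c > 0"
  proof -
    have lim: "(\<Phi> \<longlongrightarrow> 1) at_top" and zero: "\<Phi> 0 = 0"
      using assms(4) by (auto simp: solves_bvp_def)
    have "eventually (\<lambda>x. \<Phi> x > 1 / 2 \<and> x > 0) at_top"
      by (intro eventually_conj order_tendstoD(1)[OF lim] eventually_gt_at_top) auto
    then obtain b where b: "\<Phi> b > 1 / 2" "b > 0"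
      by (auto simp: eventually_at_top_linorder)
    have "continuous (at x within {0..b}) \<Phi>" if "x \<in> {0..b}" for x
    proof (cases "x = 0")
      case True
      have "continuous (at 0 within {0..}) \<Phi>"
        using assms(3) by (intro real_analytic_on_imp_continuous_within_0) (auto simp: K_def)
      then show ?thesis using True by (auto intro: continuous_within_subset)
    next
      case False
      then show ?thesis
        using that \<Phi>'[of x] by (auto intro: continuous_at_imp_continuous_at_within DERIV_isCont)
    qed
    then have "continuous_on {0..b} \<Phi>"
      by (simp add: continuous_on_eq_continuous_within)
    moreover have "\<Phi> differentiable (at x)" if "0 < x" for x
      using \<Phi>'[OF that] by (auto simp: real_differentiable_def)
    ultimately obtain l z
      where z: "0 < z" "(\<Phi> has_real_derivative l) (at z)" and "\<Phi> b - \<Phi> 0 = (b - 0) * l"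
      using MVT[of 0 b \<Phi>] b(2) by blast
    then have "0 < b * l" using b zero by simp
    then have "l > 0" using b(2) by (rule zero_less_mult_pos)
    then show ?thesis
      using that[of z] w_sgn[of z] z by (auto simp: DERIV_imp_deriv)
  qed

  have w_pos: "w x > 0" if x: "x > 0" for x
  proof (rule ccontr)
    assume "\<not> w x > 0"
    \<comment> \<open>A nonpositive value at \<open>x\<close> and a positive one at \<open>c\<close>
      force a zero of \<open>w\<close> by connectedness; that zero would propagate to
      \<open>c\<close>.\<close>
    moreover have "continuous_on {0<..} w"
      by (intro continuous_at_imp_continuous_on) (auto intro: DERIV_isCont w')
    then have "connected (w ` {0<..})"
      by (rule connected_continuous_image) simp
    ultimately have "0 \<in> w ` {0<..}"
      using connectedD_interval[of "w ` {0<..}" "w x" "w c" 0] c x by simp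
    then obtain t where "t > 0" "w t = 0" by auto
    then have "w c = 0"
      using linear_decay_zero[of w g t c] w_linear g c by auto
    with c show False by simp
  qed

  show ?thesis
  proof (intro allI impI conjI)
    fix x :: real assume x: "x > 0"
    show "0 \<le> \<Phi> x" "\<Phi> x \<le> 1" using bounds x by auto
    show pos: "deriv \<Phi> x > 0" using w_sgn w_pos x by blast
    \<comment> \<open>Only \<open>\<Phi>\<close> and the flux are known to be differentiable, so the
      second derivative is obtained by writing \<open>deriv \<Phi>\<close> as
      \<open>w / (1 + \<delta> * \<Phi>)\<close> near \<open>x\<close> and applying the quotient
      rule.\<close>
    let ?D = "(- 2 * x * deriv \<Phi> x * (1 + \<delta> * \<Phi> x) - w x * (\<delta> * deriv \<Phi> x)) / (1 + \<delta> * \<Phi> x)\<^sup>2"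
    have "((\<lambda>t. w t / (1 + \<delta> * \<Phi> t)) has_real_derivative ?D) (at x)"
      using coeff[OF x]
      by (auto intro!: derivative_eq_intros w' \<Phi>' x simp: power2_eq_square)
    moreover have ev: "\<forall>\<^sub>F t in nhds x. w t / (1 + \<delta> * \<Phi> t) = deriv \<Phi> t"
    proof (rule eventually_mono)
      show "\<forall>\<^sub>F t in nhds x. t \<in> {0<..}"
        using x by (intro eventually_nhds_in_open) auto
      show "w t / (1 + \<delta> * \<Phi> t) = deriv \<Phi> t" if "t \<in> {0<..}" for t
        using coeff[of t] that by (simp add: w_def)
    qed
    ultimately have "(deriv \<Phi> has_real_derivative ?D) (at x)"
      using DERIV_cong_ev[OF refl ev refl] by simp
    then have "deriv (deriv \<Phi>) x = ?D" by (rule DERIV_imp_deriv)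
    also have "?D < 0"
    proof (rule divide_neg_pos)
      \<comment> \<open>Both terms subtracted in the numerator of \<open>?D\<close> are positive,
        since \<open>deriv \<Phi> x\<close>, \<open>w x\<close> and \<open>\<delta>\<close>
        are.\<close>
      have "0 < 2 * x * deriv \<Phi> x * (1 + \<delta> * \<Phi> x)" "0 < w x * (\<delta> * deriv \<Phi> x)"
        using x pos coeff[OF x] w_pos[OF x] assms(1) by (auto intro!: mult_pos_pos)
      then show "- 2 * x * deriv \<Phi> x * (1 + \<delta> * \<Phi> x) - w x * (\<delta> * deriv \<Phi> x) < 0"
        by simp
      show "0 < (1 + \<delta> * \<Phi> x)\<^sup>2" using coeff[OF x] by simp
    qed
    finally show "deriv (deriv \<Phi>) x < 0" .
  qed
qed

end
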